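(* Let $\mathcal N(y|x)$ be a classical channel with finite input and output alphabets and let $0\le\epsilon<1$. Then $$C^{(1)}_{\mathrm{NS}}(\mathcal N,\epsilon)=C^{(1)}_{\mathrm{NS}\cap\mathrm{PPT}}(\mathcal N,\epsilon)=R^{PPV}(\mathcal N,\epsilon),$$ where $R^{PPV}$ is the Polyanskiy-Poor-Verdú converse bound $$R^{PPV}(\mathcal N,\epsilon)=\log\max\Big\{\sum_xs_x:\ 0\le Q_{xy}\le s_x\ \ \forall x,y,\ \ \sum_xQ_{xy}\le1\ \ \forall y,\ \ \sum_{x,y}\mathcal N(y|x)Q_{xy}\ge(1-\epsilon)\sum_xs_x\Big\}.$$
   Context: $\log$ is base 2. The classical channel $\mathcal N(y|x)$ is regarded as the quantum channel $\mathcal N(\omega)=\sum_{x,y}\langle x|\omega|x\rangle\,\mathcal N(y|x)\,|y\rangle\langle y|$ from $A=\mathbb C^X$ to $B=\mathbb C^Y$, with Choi matrix $J_{\mathcal N}=\sum_{x,y}\mathcal N(y|x)|x\rangle\langle x|\otimes|y\rangle\langle y|$. $T_B$ is the partial transpose on $B$. The one-shot $\epsilon$-error classical capacity assisted by no-signalling and PPT-preserving codes is given by $$C^{(1)}_{\mathrm{NS}\cap\mathrm{PPT}}(\mathcal N,\epsilon)=-\log\min\{\eta:\ 0\le F_{AB}\le\rho_A\otimes\mathbb 1_B,\ \operatorname{Tr}\rho_A=1,\ \operatorname{Tr}_AF_{AB}=\eta\mathbb 1_B,\ \operatorname{Tr}J_{\mathcal N}F_{AB}\ge1-\epsilon,\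 0\le F_{AB}^{T_B}\le\rho_A\otimes\mathbb 1_B\},$$ the minimum being over real $\eta$ and Hermitian $F_{AB}\in\mathcal L(A\otimes B)$, $\rho_A\in\mathcal L(A)$. The one assisted by no-signalling codes, $C^{(1)}_{\mathrm{NS}}(\mathcal N,\epsilon)$, is given by the same program without the last constraint. *)

theory Defs
  imports "HOL-Analysis.Analysis"
begin

text \<open>
  Operators on \<open>\<complex>\<^sup>X\<close> are square matrices indexed by the finite type of the alphabet \<open>X\<close>,
  with \<open>A $ i $ j\<close> the entry in row \<open>i\<close> and column \<open>j\<close>; operators on a tensor product are
  matrices indexed by pairs.
\<close>

type_synonym 'n cmat = "complex ^ 'n ^ 'n"

definition hermitian :: "'n::finite cmat \<Rightarrow> bool" where
  "hermitian A \<longleftrightarrow> (\<forall>i j. cnj (A $ j $ i) = A $ i $ j)"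

text \<open>The quadratic form of a Hermitian matrix is real, so taking \<open>Re\<close> loses nothing.\<close>

definition psd :: "'n::finite cmat \<Rightarrow> bool" where
  "psd A \<longleftrightarrow> hermitian A \<and> (\<forall>v. 0 \<le> Re (\<Sum>i\<in>UNIV. cnj (v $ i) * (A *v v) $ i))"

definition loewner_le :: "'n::finite cmat \<Rightarrow> 'n cmat \<Rightarrow> bool" (infix "\<preceq>" 50) where
  "A \<preceq> B \<longleftrightarrow> psd (B - A)"

definition kron :: "'a::finite cmat \<Rightarrow> 'b::finite cmat \<Rightarrow> ('a \<times> 'b) cmat" where
  "kron A B = (\<chi> p q. A $ fst p $ fst q * B $ snd p $ snd q)"

definition ketbra :: "'n::finite \<Rightarrow> 'n \<Rightarrow> 'n cmat" where
  "ketbra i j = (\<chi> k l. if k = i \<and> l = j then 1 else 0)"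

definition ptrace_fst :: "('a::finite \<times> 'b::finite) cmat \<Rightarrow> 'b cmat" where
  "ptrace_fst F = (\<chi> y y'. \<Sum>x\<in>UNIV. F $ (x, y) $ (x, y'))"

definition ptranspose_snd :: "('a::finite \<times> 'b::finite) cmat \<Rightarrow> ('a \<times> 'b) cmat" where
  "ptranspose_snd F = (\<chi> p q. F $ (fst p, snd q) $ (fst q, snd p))"

definition choi :: "('a::finite cmat \<Rightarrow> 'b::finite cmat) \<Rightarrow> ('a \<times> 'b) cmat" where
  "choi \<N> = (\<Sum>i\<in>UNIV. \<Sum>j\<in>UNIV. kron (ketbra i j) (\<N> (ketbra i j)))"

text \<open>A classical channel is given by \<open>W x y\<close>, the probability of output \<open>y\<close> on input \<open>x\<close>.\<close>

definition classical_channel :: "('x::finite \<Rightarrow> 'y::finite \<Rightarrow> real) \<Rightarrow> bool" where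
  "classical_channel W \<longleftrightarrow> (\<forall>x y. 0 \<le> W x y) \<and> (\<forall>x. (\<Sum>y\<in>UNIV. W x y) = 1)"

definition quantum_of :: "('x::finite \<Rightarrow> 'y::finite \<Rightarrow> real) \<Rightarrow> 'x cmat \<Rightarrow> 'y cmat" where
  "quantum_of W \<omega> =
     (\<chi> i j. \<Sum>x\<in>UNIV. \<Sum>y\<in>UNIV. \<omega> $ x $ x * complex_of_real (W x y) * ketbra y y $ i $ j)"

lemma choi_quantum_of:
  "choi (quantum_of W) =
     (\<Sum>x\<in>UNIV. \<Sum>y\<in>UNIV. W x y *\<^sub>R kron (ketbra x x) (ketbra y y))"
proof -
  have "choi (quantum_of W) $ (a, b) $ (c, d) =
     (\<Sum>x\<in>UNIV. \<Sum>y\<in>UNIV. W x y *\<^sub>R kron (ketbra x x) (ketbra y y)) $ (a, b) $ (c, d)"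
    for a b c d
  proof -
    have ite: "(if P \<and> Q then z else 0) = (if P then (if Q then z else 0) else 0)"
      for P Q and z :: complex by simp
    show ?thesis
      by (cases "a = c"; cases "b = d")
        (simp_all add: choi_def quantum_of_def kron_def ketbra_def ite scaleR_conv_of_real[where 'a=complex]
          if_distrib[where f="\<lambda>z. z * _"] if_distrib[where f="\<lambda>z. _ * z"]
          sum.If_cases cong: if_cong)
  qed
  then show ?thesis by (simp add: vec_eq_iff split_paired_all)
qed

text \<open>
  In the constraint on \<open>Tr (J F)\<close> the trace is real, since the Choi matrix of a
  Hermiticity-preserving map and \<open>F\<close> are both Hermitian.
\<close>

definition ns_feasible ::
  "('a::finite cmat \<Rightarrow> 'b::finite cmat) \<Rightarrow> real \<Rightarrow> real \<Rightarrow> ('a \<times> 'b) cmat \<Rightarrow> 'a cmat \<Rightarrow> bool" where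
  "ns_feasible \<N> \<epsilon> \<eta> F \<rho> \<longleftrightarrow>
     hermitian F \<and> hermitian \<rho> \<and>
     0 \<preceq> F \<and> F \<preceq> kron \<rho> (mat 1) \<and>
     trace \<rho> = 1 \<and>
     ptrace_fst F = mat (complex_of_real \<eta>) \<and>
     Re (trace (choi \<N> ** F)) \<ge> 1 - \<epsilon>"

definition ns_ppt_feasible ::
  "('a::finite cmat \<Rightarrow> 'b::finite cmat) \<Rightarrow> real \<Rightarrow> real \<Rightarrow> ('a \<times> 'b) cmat \<Rightarrow> 'a cmat \<Rightarrow> bool" where
  "ns_ppt_feasible \<N> \<epsilon> \<eta> F \<rho> \<longleftrightarrow>
     ns_feasible \<N> \<epsilon> \<eta> F \<rho> \<and>
     0 \<preceq> ptranspose_snd F \<and> ptranspose_snd F \<preceq> kron \<rho> (mat 1)"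

definition ns_values :: "('a::finite cmat \<Rightarrow> 'b::finite cmat) \<Rightarrow> real \<Rightarrow> real set" where
  "ns_values \<N> \<epsilon> = {\<eta>. \<exists>F \<rho>. ns_feasible \<N> \<epsilon> \<eta> F \<rho>}"

definition ns_ppt_values :: "('a::finite cmat \<Rightarrow> 'b::finite cmat) \<Rightarrow> real \<Rightarrow> real set" where
  "ns_ppt_values \<N> \<epsilon> = {\<eta>. \<exists>F \<rho>. ns_ppt_feasible \<N> \<epsilon> \<eta> F \<rho>}"

definition ppv_values :: "('x::finite \<Rightarrow> 'y::finite \<Rightarrow> real) \<Rightarrow> real \<Rightarrow> real set" where
  "ppv_values W \<epsilon> = {(\<Sum>x\<in>UNIV. s x) | s Q.
     (\<forall>x y. 0 \<le> Q x y \<and> Q x y \<le> s x) \<and>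
     (\<forall>y. (\<Sum>x\<in>UNIV. Q x y) \<le> 1) \<and>
     (\<Sum>x\<in>UNIV. \<Sum>y\<in>UNIV. W x y * Q x y) \<ge> (1 - \<epsilon>) * (\<Sum>x\<in>UNIV. s x)}"

text \<open>
  \<open>Min\<close> and \<open>Max\<close> are for finite sets only, so optimal values are rendered by \<open>LEAST\<close> and
  \<open>GREATEST\<close>; these are meaningful when the optimum is attained, which the predicates
  \<open>has_minimum\<close> and \<open>has_maximum\<close> express.
\<close>

definition has_minimum :: "real set \<Rightarrow> bool" where
  "has_minimum S \<longleftrightarrow> (\<exists>m\<in>S. \<forall>x\<in>S. m \<le> x)"

definition has_maximum :: "real set \<Rightarrow> bool" where
  "has_maximum S \<longleftrightarrow> (\<exists>m\<in>S. \<forall>x\<in>S. x \<le> m)"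

definition C_NS :: "('a::finite cmat \<Rightarrow> 'b::finite cmat) \<Rightarrow> real \<Rightarrow> real" where
  "C_NS \<N> \<epsilon> = - log 2 (LEAST \<eta>. \<eta> \<in> ns_values \<N> \<epsilon>)"

definition C_NS_PPT :: "('a::finite cmat \<Rightarrow> 'b::finite cmat) \<Rightarrow> real \<Rightarrow> real" where
  "C_NS_PPT \<N> \<epsilon> = - log 2 (LEAST \<eta>. \<eta> \<in> ns_ppt_values \<N> \<epsilon>)"

definition R_PPV :: "('x::finite \<Rightarrow> 'y::finite \<Rightarrow> real) \<Rightarrow> real \<Rightarrow> real" where
  "R_PPV W \<epsilon> = log 2 (GREATEST r. r \<in> ppv_values W \<epsilon>)"

end

theory Submission
  imports Defs
begin

text \<open>
  The Choi matrix of a classical channel is diagonal, so only the diagonals of \<open>F\<close> and \<open>\<rho>\<close> enter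
  the program, and diagonal matrices are fixed by the partial transpose. Hence both capacity
  programs have the same values as one linear program. Dividing a feasible point of it by
  \<open>\<eta>\<close> gives a feasible point of the converse program with value \<open>1 / \<eta>\<close>. In the other direction
  the constraint \<open>\<Sum>\<^sub>x Q\<^sub>x\<^sub>y \<le> 1\<close> has to be turned into an equality. This is possible by moving
  each column of \<open>Q\<close> towards \<open>s\<close> as soon as \<open>\<Sum>\<^sub>x s\<^sub>x \<ge> 1\<close>, and the optimal value is at least \<open>1\<close>.
\<close>

section \<open>Diagonal matrices\<close>

text \<open>Real entries make such a matrix Hermitian at once and turn the Loewner order into a
  family of real inequalities.\<close>

definition cdiag :: "('n::finite \<Rightarrow> real) \<Rightarrow> 'n cmat" where
  "cdiag d = (\<chi> i j. if i = j then complex_of_real (d i) else 0)"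

lemma cdiag_diff: "cdiag a - cdiag b = cdiag (\<lambda>i. a i - b i)"
  by (simp add: cdiag_def vec_eq_iff)

lemma hermitian_cdiag: "hermitian (cdiag d)"
  by (simp add: cdiag_def hermitian_def)

lemma trace_cdiag: "trace (cdiag d) = complex_of_real (\<Sum>i\<in>UNIV. d i)"
  by (simp add: cdiag_def trace_def)

lemma trace_cdiag_mult: "trace (cdiag d ** F) = (\<Sum>i\<in>UNIV. complex_of_real (d i) * F $ i $ i)"
  by (simp add: cdiag_def trace_def matrix_matrix_mult_def if_distrib[where f="\<lambda>z. z * _"]
      cong: if_cong)

text \<open>The quadratic form at a standard basis vector is the corresponding diagonal
  entry.\<close>

lemma psd_diag_nonneg:
  assumes "psd A"
  shows "0 \<le> Re (A $ i $ i)"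
proof -
  have "(\<Sum>k\<in>UNIV. cnj (axis i 1 $ k) * (A *v axis i 1) $ k) = A $ i $ i"
    by (simp add: axis_def matrix_vector_mult_def if_distrib[where f="\<lambda>z. z * _"]
        if_distrib[where f="\<lambda>z. _ * z"] if_distrib[where f=cnj] cong: if_cong)
  with assms show ?thesis
    unfolding psd_def by metis
qed

text \<open>The quadratic form at \<open>v\<close> is the sum of \<open>d i\<close> times the
  squared modulus of \<open>v $ i\<close>.\<close>

lemma psd_cdiag:
  assumes "\<And>i. 0 \<le> d i"
  shows "psd (cdiag d)"
proof -
  have "0 \<le> Re (\<Sum>i\<in>UNIV. cnj (v $ i) * (cdiag d *v v) $ i)" for v
  proof -
    have "(cdiag d *v v) $ i = complex_of_real (d i) * v $ i" for i
      by (simp add: cdiag_def matrix_vector_mult_def if_distrib[where f="\<lambda>z. z * _"]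
          cong: if_cong)
    moreover have "Re (cnj z * (complex_of_real c * z)) = c * (cmod z)\<^sup>2" for z c
      by (simp add: cmod_power2) (simp add: power2_eq_square algebra_simps)
    ultimately show ?thesis
      by (simp add: Re_sum assms sum_nonneg del: complex_cnj_mult times_complex.simps)
  qed
  then show ?thesis
    by (simp add: psd_def hermitian_cdiag)
qed

lemma loewner_le_diag:
  assumes "A \<preceq> B"
  shows "Re (A $ i $ i) \<le> Re (B $ i $ i)"
  using psd_diag_nonneg[of "B - A" i] assms by (simp add: loewner_le_def)

lemma loewner_le_cdiag: "(\<And>i. a i \<le> b i) \<Longrightarrow> cdiag a \<preceq> cdiag b"
  by (simp add: loewner_le_def cdiag_diff psd_cdiag)

lemma zero_eq_cdiag: "0 = cdiag (\<lambda>_. 0)"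
  by (simp add: cdiag_def vec_eq_iff)

lemma kron_cdiag_mat_1: "kron (cdiag d) (mat 1) = cdiag (\<lambda>p. d (fst p))"
  by (auto simp: kron_def cdiag_def mat_def vec_eq_iff)

lemma ptranspose_snd_cdiag: "ptranspose_snd (cdiag d) = cdiag d"
  by (auto simp: ptranspose_snd_def cdiag_def vec_eq_iff)

lemma ptrace_fst_cdiag:
  "ptrace_fst (cdiag d) = cdiag (\<lambda>y. \<Sum>x\<in>UNIV. d (x, y))"
  by (auto simp: ptrace_fst_def cdiag_def vec_eq_iff)

lemma choi_quantum_of_cdiag: "choi (quantum_of W) = cdiag (\<lambda>p. W (fst p) (snd p))"
proof -
  have "choi (quantum_of W) $ (a, b) $ (c, d) = cdiag (\<lambda>p. W (fst p) (snd p)) $ (a, b) $ (c, d)"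
    for a b c d
  proof -
    have ite: "(if P \<and> Q then z else 0) = (if P then (if Q then z else 0) else 0)"
      for P Q and z :: complex by simp
    show ?thesis
      by (cases "a = c"; cases "b = d")
        (simp_all add: choi_quantum_of cdiag_def kron_def ketbra_def ite
          scaleR_conv_of_real[where 'a=complex]
          if_distrib[where f="\<lambda>z. z * _"] if_distrib[where f="\<lambda>z. _ * z"]
          sum.If_cases cong: if_cong)
  qed
  then show ?thesis by (simp add: vec_eq_iff split_paired_all)
qed

lemma trace_choi_quantum_of:
  "Re (trace (choi (quantum_of W) ** F)) =
     (\<Sum>x\<in>UNIV. \<Sum>y\<in>UNIV. W x y * Re (F $ (x, y) $ (x, y)))"
  by (simp add: choi_quantum_of_cdiag trace_cdiag_mult Re_sum sum.cartesian_product
      case_prod_beta)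

section \<open>Reduction to a linear program\<close>

text \<open>\<open>f\<close> and \<open>p\<close> stand for the diagonals of \<open>F\<close> and
  \<open>\<rho>\<close>; off-diagonal entries have disappeared from the program.\<close>

definition lp_values :: "('x::finite \<Rightarrow> 'y::finite \<Rightarrow> real) \<Rightarrow> real \<Rightarrow> real set" where
  "lp_values W \<epsilon> = {\<eta>. \<exists>f p.
     (\<forall>x y. 0 \<le> f x y \<and> f x y \<le> p x) \<and> (\<Sum>x\<in>UNIV. p x) = 1 \<and>
     (\<forall>y. (\<Sum>x\<in>UNIV. f x y) = \<eta>) \<and>
     (\<Sum>x\<in>UNIV. \<Sum>y\<in>UNIV. W x y * f x y) \<ge> 1 - \<epsilon>}"

text \<open>Loewner inequalities pass to diagonal entries, and both the partial trace and the
  success constraint are read off there.\<close>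

lemma ns_values_subset_lp_values: "ns_values (quantum_of W) \<epsilon> \<subseteq> lp_values W \<epsilon>"
proof
  fix \<eta> assume "\<eta> \<in> ns_values (quantum_of W) \<epsilon>"
  then obtain F \<rho> where feas: "ns_feasible (quantum_of W) \<epsilon> \<eta> F \<rho>"
    by (auto simp: ns_values_def)
  define f where "f x y = Re (F $ (x, y) $ (x, y))" for x y
  define p where "p x = Re (\<rho> $ x $ x)" for x
  have "0 \<le> f x y" for x y
    using loewner_le_diag[of 0 F "(x, y)"] feas by (simp add: ns_feasible_def f_def)
  moreover have "f x y \<le> p x" for x y
    using loewner_le_diag[of F "kron \<rho> (mat 1)" "(x, y)"] feas
    by (simp add: ns_feasible_def f_def p_def kron_def mat_def)
  moreover have "(\<Sum>x\<in>UNIV. p x) = 1"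
  proof -
    have "(\<Sum>x\<in>UNIV. p x) = Re (trace \<rho>)"
      by (simp add: p_def trace_def Re_sum)
    with feas show ?thesis by (simp add: ns_feasible_def)
  qed
  moreover have "(\<Sum>x\<in>UNIV. f x y) = \<eta>" for y
  proof -
    have "(\<Sum>x\<in>UNIV. f x y) = Re (ptrace_fst F $ y $ y)"
      by (simp add: f_def ptrace_fst_def Re_sum)
    with feas show ?thesis by (simp add: ns_feasible_def mat_def)
  qed
  moreover have "(\<Sum>x\<in>UNIV. \<Sum>y\<in>UNIV. W x y * f x y) \<ge> 1 - \<epsilon>"
    using feas by (simp add: ns_feasible_def f_def trace_choi_quantum_of)
  ultimately show "\<eta> \<in> lp_values W \<epsilon>"
    unfolding lp_values_def by blast
qed

text \<open>The diagonal matrices built from \<open>f\<close> and \<open>p\<close> serve as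
  \<open>F\<close> and \<open>\<rho>\<close>. Since \<open>F\<close> equals its partial transpose,
  the PPT constraints repeat those on \<open>F\<close>.\<close>

lemma lp_values_subset_ns_ppt_values: "lp_values W \<epsilon> \<subseteq> ns_ppt_values (quantum_of W) \<epsilon>"
proof
  fix \<eta> assume "\<eta> \<in> lp_values W \<epsilon>"
  then obtain f p where fp: "\<And>x y. 0 \<le> f x y" "\<And>x y. f x y \<le> p x" "(\<Sum>x\<in>UNIV. p x) = 1"
    "\<And>y. (\<Sum>x\<in>UNIV. f x y) = \<eta>" "(\<Sum>x\<in>UNIV. \<Sum>y\<in>UNIV. W x y * f x y) \<ge> 1 - \<epsilon>"
    by (auto simp: lp_values_def)
  define F where "F = cdiag (\<lambda>q. f (fst q) (snd q))"
  have "0 \<preceq> F"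
    unfolding F_def zero_eq_cdiag by (rule loewner_le_cdiag) (simp add: fp)
  moreover have "F \<preceq> kron (cdiag p) (mat 1)"
    unfolding F_def kron_cdiag_mat_1 by (rule loewner_le_cdiag) (simp add: fp)
  moreover have "ptrace_fst F = mat (complex_of_real \<eta>)"
    unfolding F_def ptrace_fst_cdiag by (simp add: fp cdiag_def mat_def)
  moreover have "Re (trace (choi (quantum_of W) ** F)) \<ge> 1 - \<epsilon>"
    by (simp add: trace_choi_quantum_of F_def cdiag_def fp)
  moreover have "ptranspose_snd F = F"
    by (simp add: F_def ptranspose_snd_cdiag)
  moreover have "hermitian F"
    by (simp add: F_def hermitian_cdiag)
  ultimately have "ns_ppt_feasible (quantum_of W) \<epsilon> \<eta> F (cdiag p)"
    by (simp add: ns_ppt_feasible_def ns_feasible_def hermitian_cdiag trace_cdiag fp)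
  then show "\<eta> \<in> ns_ppt_values (quantum_of W) \<epsilon>"
    by (auto simp: ns_ppt_values_def)
qed

lemma ns_ppt_values_subset_ns_values: "ns_ppt_values \<N> \<epsilon> \<subseteq> ns_values \<N> \<epsilon>"
  by (auto simp: ns_ppt_values_def ns_values_def ns_ppt_feasible_def)

text \<open>The three inclusions between the sets of values form a cycle.\<close>

lemma ns_values_eq_lp_values: "ns_values (quantum_of W) \<epsilon> = lp_values W \<epsilon>"
  and ns_ppt_values_eq_lp_values: "ns_ppt_values (quantum_of W) \<epsilon> = lp_values W \<epsilon>"
  using ns_values_subset_lp_values[of W \<epsilon>] lp_values_subset_ns_ppt_values[of W \<epsilon>]
    ns_ppt_values_subset_ns_values[of "quantum_of W" \<epsilon>] by auto

section \<open>The converse program\<close>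

lemma classical_channel_le_1:
  assumes "classical_channel W"
  shows "W x y \<le> 1"
  using assms member_le_sum[of y UNIV "W x"] by (auto simp: classical_channel_def)

text \<open>Replacing every \<open>W x y\<close> by the bound \<open>1\<close> leaves the sum of the
  column sums of \<open>Q\<close>. The estimate is crude, but it suffices for positivity of
  \<open>\<eta>\<close> and for boundedness of the converse program.\<close>

lemma channel_sum_le:
  assumes "classical_channel W" and "\<And>x y. 0 \<le> Q x y" and "\<And>y. (\<Sum>x\<in>UNIV. Q x y) \<le> c"
  shows "(\<Sum>x\<in>UNIV. \<Sum>y\<in>(UNIV::'y::finite set). W x y * Q x y) \<le> real CARD('y) * c"
proof -
  have "(\<Sum>x\<in>UNIV. \<Sum>y\<in>UNIV. W x y * Q x y) \<le> (\<Sum>x\<in>UNIV. \<Sum>y\<in>UNIV. Q x y)"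
    using assms classical_channel_le_1[OF assms(1)]
    by (intro sum_mono mult_left_le_one_le) (auto simp: classical_channel_def)
  also have "\<dots> = (\<Sum>y\<in>UNIV. \<Sum>x\<in>UNIV. Q x y)"
    by (rule sum.swap)
  also have "\<dots> \<le> (\<Sum>y\<in>(UNIV::'y set). c)"
    by (intro sum_mono assms)
  finally show ?thesis by simp
qed

text \<open>The success term is at least \<open>1 - \<epsilon> > 0\<close>, which forces the common
  column sum to be positive. This permits division by \<open>\<eta>\<close>.\<close>

lemma lp_values_pos:
  fixes W :: "'x::finite \<Rightarrow> 'y::finite \<Rightarrow> real"
  assumes "classical_channel W" and "\<epsilon> < 1" and "\<eta> \<in> lp_values W \<epsilon>"
  shows "0 < \<eta>"
proof -
  obtain f p where fp: "\<And>x y. 0 \<le> f x y" "\<And>x y. f x y \<le> p x"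
    "\<And>y. (\<Sum>x\<in>UNIV. f x y) = \<eta>" "(\<Sum>x\<in>UNIV. \<Sum>y\<in>UNIV. W x y * f x y) \<ge> 1 - \<epsilon>"
    using assms(3) by (auto simp: lp_values_def)
  have "0 < real CARD('y) * \<eta>"
    using channel_sum_le[OF assms(1), of f \<eta>] fp assms(2) by simp
  then show ?thesis
    by (simp add: zero_less_mult_iff)
qed

section \<open>Reciprocals between the two linear programs\<close>

lemma inverse_lp_value_in_ppv_values:
  assumes "0 < \<eta>" and "\<eta> \<in> lp_values W \<epsilon>"
  shows "1 / \<eta> \<in> ppv_values W \<epsilon>"
proof -
  obtain f p where fp: "\<And>x y. 0 \<le> f x y" "\<And>x y. f x y \<le> p x" "(\<Sum>x\<in>UNIV. p x) = 1"
    "\<And>y. (\<Sum>x\<in>UNIV. f x y) = \<eta>" "(\<Sum>x\<in>UNIV. \<Sum>y\<in>UNIV. W x y * f x y) \<ge> 1 - \<epsilon>"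
    using assms(2) by (auto simp: lp_values_def)
  \<comment> \<open>After this scaling the column sums are exactly \<open>1\<close>, and the
    normalization of \<open>p\<close> makes the total of \<open>s\<close> equal to
    \<open>1 / \<eta>\<close>.\<close>
  define s where "s x = p x / \<eta>" for x
  define Q where "Q x y = f x y / \<eta>" for x y
  have s: "1 / \<eta> = (\<Sum>x\<in>UNIV. s x)"
    by (simp add: s_def fp flip: sum_divide_distrib)
  have "0 \<le> Q x y \<and> Q x y \<le> s x" for x y
    using fp assms(1) by (simp add: Q_def s_def divide_right_mono)
  moreover have "(\<Sum>x\<in>UNIV. Q x y) \<le> 1" for y
    using assms(1) by (simp add: Q_def fp flip: sum_divide_distrib)
  moreover have "(\<Sum>x\<in>UNIV. \<Sum>y\<in>UNIV. W x y * Q x y) \<ge> (1 - \<epsilon>) * (\<Sum>x\<in>UNIV. s x)"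
    using fp(5) assms(1)
    by (simp add: Q_def divide_right_mono flip: sum_divide_distrib s)
  ultimately show ?thesis
    unfolding ppv_values_def using s by blast
qed

text \<open>In each column, \<open>1\<close> lies between the total of \<open>Q\<close> and the
  total \<open>r\<close> of \<open>s\<close>, so some convex combination of the two has total
  \<open>1\<close>. Dividing by \<open>r\<close> then normalizes \<open>s\<close>.\<close>

lemma inverse_ppv_value_in_lp_values:
  assumes "classical_channel W" and "1 \<le> r" and "r \<in> ppv_values W \<epsilon>"
  shows "1 / r \<in> lp_values W \<epsilon>"
proof -
  obtain s Q where r: "r = (\<Sum>x\<in>UNIV. s x)"
    and Q: "\<And>x y. 0 \<le> Q x y" "\<And>x y. Q x y \<le> s x" "\<And>y. (\<Sum>x\<in>UNIV. Q x y) \<le> 1"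
      "(\<Sum>x\<in>UNIV. \<Sum>y\<in>UNIV. W x y * Q x y) \<ge> (1 - \<epsilon>) * r"
    using assms(3) by (auto simp: ppv_values_def)
  define q where "q y = (\<Sum>x\<in>UNIV. Q x y)" for y
  \<comment> \<open>If \<open>r = q y\<close>, then both are \<open>1\<close>, and the junk value \<open>t y = 0\<close> is the right one.\<close>
  define t where "t y = (1 - q y) / (r - q y)" for y
  define Q' where "Q' x y = Q x y + t y * (s x - Q x y)" for x y
  have q: "q y \<le> 1" for y
    by (simp add: q_def Q)
  have t: "0 \<le> t y" "t y \<le> 1" for y
    using q[of y] assms(2) by (auto simp: t_def divide_le_eq)
  have Q_le: "Q x y \<le> Q' x y" for x y
    using t Q by (simp add: Q'_def)
  have "t y * (s x - Q x y) \<le> s x - Q x y" for x y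
    using t[of y] Q(2)[of x y] by (intro mult_left_le_one_le) auto
  then have Q'_le: "Q' x y \<le> s x" for x y
    by (simp add: Q'_def algebra_simps)
  have Q'_sum: "(\<Sum>x\<in>UNIV. Q' x y) = 1" for y
  proof -
    have "(\<Sum>x\<in>UNIV. Q' x y) = q y + t y * (r - q y)"
      by (simp add: Q'_def q_def r sum.distrib sum_subtractf flip: sum_distrib_left)
    also have "\<dots> = 1"
      using q[of y] assms(2) by (cases "r = q y") (auto simp: t_def)
    finally show ?thesis .
  qed
  \<comment> \<open>The channel is nonnegative, so passing from \<open>Q\<close> to the larger
    \<open>Q'\<close> cannot spoil the success constraint.\<close>
  have "(\<Sum>x\<in>UNIV. \<Sum>y\<in>UNIV. W x y * Q x y) \<le> (\<Sum>x\<in>UNIV. \<Sum>y\<in>UNIV. W x y * Q' x y)"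
    using assms(1) Q_le by (intro sum_mono mult_left_mono) (auto simp: classical_channel_def)
  then have WQ': "(1 - \<epsilon>) * r \<le> (\<Sum>x\<in>UNIV. \<Sum>y\<in>UNIV. W x y * Q' x y)"
    using Q(4) by linarith
  define f where "f x y = Q' x y / r" for x y
  define p where "p x = s x / r" for x
  have "0 \<le> f x y \<and> f x y \<le> p x" for x y
    using Q_le[of x y] Q(1)[of x y] Q'_le[of x y] assms(2)
    by (simp add: f_def p_def divide_right_mono)
  moreover have "(\<Sum>x\<in>UNIV. p x) = 1"
    using assms(2) by (simp add: p_def flip: sum_divide_distrib r)
  moreover have "(\<Sum>x\<in>UNIV. f x y) = 1 / r" for y
    by (simp add: f_def Q'_sum flip: sum_divide_distrib)
  moreover have "(\<Sum>x\<in>UNIV. \<Sum>y\<in>UNIV. W x y * f x y) \<ge> 1 - \<epsilon>"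
    using WQ' assms(2) by (simp add: f_def le_divide_eq flip: sum_divide_distrib)
  ultimately show ?thesis
    unfolding lp_values_def by blast
qed

section \<open>Attainment of the converse optimum\<close>

lemma one_in_ppv_values:
  fixes W :: "'x::finite \<Rightarrow> 'y::finite \<Rightarrow> real"
  assumes "classical_channel W" and "0 \<le> \<epsilon>"
  shows "1 \<in> ppv_values W \<epsilon>"
proof -
  \<comment> \<open>\<open>undefined\<close> is just some input letter. All weight goes to it and
    \<open>Q\<close> repeats \<open>s\<close> in every column; as the rows of \<open>W\<close> sum
    to \<open>1\<close>, the success term equals the total of \<open>s\<close>.\<close>
  define s where "s x = (if x = undefined then 1 else 0 :: real)" for x :: 'x
  have s: "1 = (\<Sum>x\<in>UNIV. s x)"
    by (simp add: s_def)
  have "(\<Sum>x\<in>UNIV. \<Sum>y\<in>UNIV. W x y * s x) = (\<Sum>x\<in>UNIV. s x)"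
    using assms(1) by (simp add: classical_channel_def flip: sum_distrib_right)
  then have "(\<Sum>x\<in>UNIV. \<Sum>y\<in>UNIV. W x y * s x) \<ge> (1 - \<epsilon>) * (\<Sum>x\<in>UNIV. s x)"
    using assms(2) by (simp flip: s)
  moreover have "\<forall>x (y::'y). 0 \<le> s x \<and> s x \<le> s x"
    by (simp add: s_def)
  moreover have "\<forall>y::'y. (\<Sum>x\<in>UNIV. s x) \<le> 1"
    by (simp flip: s)
  ultimately show ?thesis
    unfolding ppv_values_def using s by (intro CollectI exI[of _ s] exI[of _ "\<lambda>x y. s x"]) auto
qed

text \<open>The success constraint puts \<open>(1 - \<epsilon>) * r\<close> below the crude bound by
  the number of outputs.\<close>

lemma ppv_values_le:
  fixes W :: "'x::finite \<Rightarrow> 'y::finite \<Rightarrow> real"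
  assumes "classical_channel W" and "\<epsilon> < 1" and "r \<in> ppv_values W \<epsilon>"
  shows "r \<le> real CARD('y) / (1 - \<epsilon>)"
proof -
  obtain s Q where Q: "r = (\<Sum>x\<in>UNIV. s x)" "\<And>x y. 0 \<le> Q x y" "\<And>x y. Q x y \<le> s x"
      "\<And>y. (\<Sum>x\<in>UNIV. Q x y) \<le> 1"
      "(\<Sum>x\<in>UNIV. \<Sum>y\<in>UNIV. W x y * Q x y) \<ge> (1 - \<epsilon>) * (\<Sum>x\<in>UNIV. s x)"
    using assms(3) unfolding ppv_values_def by blast
  have "(1 - \<epsilon>) * r \<le> real CARD('y)"
    using channel_sum_le[OF assms(1), of Q 1] Q by simp
  then show ?thesis
    using assms(2) by (simp add: le_divide_eq mult.commute)
qed

text \<open>The values are the image of a compact set of feasible points under a continuous map.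
  Together with nonemptiness this yields a maximum.\<close>

lemma compact_ppv_values:
  fixes W :: "'x::finite \<Rightarrow> 'y::finite \<Rightarrow> real"
  assumes "classical_channel W" and "\<epsilon> < 1"
  shows "compact (ppv_values W \<epsilon>)"
proof -
  \<comment> \<open>\<open>B\<close> bounds the total of \<open>s\<close>, hence each of its
    nonnegative terms and each \<open>Q x y\<close>. Intersecting with the box \<open>C\<close>
    therefore loses no feasible point.\<close>
  define B where "B = real CARD('y) / (1 - \<epsilon>)"
  define C :: "((real^'x) \<times> (real^('x \<times> 'y))) set" where
    "C = cbox 0 (\<chi> _. B) \<times> cbox 0 (\<chi> _. B)"
  define K :: "((real^'x) \<times> (real^('x \<times> 'y))) set" where
    "K = {z. (\<forall>x y. 0 \<le> snd z $ (x, y) \<and> snd z $ (x, y) \<le> fst z $ x) \<and>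
             (\<forall>y. (\<Sum>x\<in>UNIV. snd z $ (x, y)) \<le> 1) \<and>
             (1 - \<epsilon>) * (\<Sum>x\<in>UNIV. fst z $ x) \<le> (\<Sum>x\<in>UNIV. \<Sum>y\<in>UNIV. W x y * snd z $ (x, y))}"
  define g :: "(real^'x) \<times> (real^('x \<times> 'y)) \<Rightarrow> real" where "g z = (\<Sum>x\<in>UNIV. fst z $ x)" for z
  have "compact C"
    unfolding C_def by (intro compact_Times compact_cbox)
  \<comment> \<open>Only non-strict inequalities between continuous functions of \<open>z\<close>
    occur.\<close>
  moreover have "closed K"
    unfolding K_def
    by (intro closed_Collect_conj closed_Collect_all closed_Collect_le continuous_intros)
  ultimately have "compact (C \<inter> K)"
    by (rule compact_Int_closed)
  moreover have "continuous_on (C \<inter> K) g"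
    unfolding g_def by (intro continuous_intros)
  ultimately have "compact (g ` (C \<inter> K))"
    by (rule compact_continuous_image[rotated])
  moreover have "g ` (C \<inter> K) = ppv_values W \<epsilon>"
  proof (intro equalityI subsetI)
    fix r assume "r \<in> g ` (C \<inter> K)"
    then obtain z where z: "z \<in> K" "r = g z" by blast
    then show "r \<in> ppv_values W \<epsilon>"
      unfolding ppv_values_def g_def K_def
      by (intro CollectI exI[of _ "\<lambda>x. fst z $ x"] exI[of _ "\<lambda>x y. snd z $ (x, y)"]) auto
  next
    fix r assume r: "r \<in> ppv_values W \<epsilon>"
    then obtain s Q where sQ: "r = (\<Sum>x\<in>UNIV. s x)" "\<And>x y. 0 \<le> Q x y" "\<And>x y. Q x y \<le> s x"
      "\<And>y. (\<Sum>x\<in>UNIV. Q x y) \<le> 1"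
      "(\<Sum>x\<in>UNIV. \<Sum>y\<in>UNIV. W x y * Q x y) \<ge> (1 - \<epsilon>) * (\<Sum>x\<in>UNIV. s x)"
      unfolding ppv_values_def by blast
    have s_nonneg: "0 \<le> s x" for x
      using sQ(2,3) order_trans by blast
    have s_le: "s x \<le> B" for x
      using ppv_values_le[OF assms r] member_le_sum[of x UNIV s] s_nonneg sQ(1)
      by (simp add: B_def)
    have Q_le: "Q x y \<le> B" for x y
      using sQ(3) s_le order_trans by blast
    define z where "z = ((\<chi> x. s x) :: real^'x, (\<chi> q. Q (fst q) (snd q)) :: real^('x \<times> 'y))"
    have "z \<in> C"
      by (simp add: C_def z_def mem_box_cart s_nonneg s_le sQ(2) Q_le)
    moreover have "z \<in> K"
      by (simp add: K_def z_def sQ)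
    moreover have "r = g z"
      by (simp add: g_def z_def sQ)
    ultimately show "r \<in> g ` (C \<inter> K)" by blast
  qed
  ultimately show ?thesis by simp
qed

section \<open>Comparison of the optimal values\<close>

theorem proposition9:
  fixes W :: "'x::finite \<Rightarrow> 'y::finite \<Rightarrow> real" and \<epsilon> :: real
  assumes "classical_channel W" and "0 \<le> \<epsilon>" and "\<epsilon> < 1"
  shows "has_minimum (ns_values (quantum_of W) \<epsilon>) \<and>
         has_minimum (ns_ppt_values (quantum_of W) \<epsilon>) \<and>
         has_maximum (ppv_values W \<epsilon>) \<and>
         C_NS (quantum_of W) \<epsilon> = C_NS_PPT (quantum_of W) \<epsilon> \<and>
         C_NS_PPT (quantum_of W) \<epsilon> = R_PPV W \<epsilon>"
proof -
  obtain m where m: "m \<in> ppv_values W \<epsilon>" "\<And>r. r \<in> ppv_values W \<epsilon> \<Longrightarrow> r \<le> m"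
    using compact_attains_sup[OF compact_ppv_values[OF assms(1,3)]] one_in_ppv_values[OF assms(1,2)]
    by blast
  \<comment> \<open>This bound is what allows the maximizer to be converted back into a point of the
    capacity program.\<close>
  have m1: "1 \<le> m"
    by (rule m(2)) (rule one_in_ppv_values[OF assms(1,2)])
  have min_in: "1 / m \<in> lp_values W \<epsilon>"
    by (rule inverse_ppv_value_in_lp_values[OF assms(1) m1 m(1)])
  \<comment> \<open>A smaller \<open>\<eta>\<close> would have a reciprocal above the maximum
    \<open>m\<close>.\<close>
  have min_le: "1 / m \<le> \<eta>" if "\<eta> \<in> lp_values W \<epsilon>" for \<eta>
  proof -
    have pos: "0 < \<eta>"
      by (rule lp_values_pos[OF assms(1,3) that])
    then have "1 / \<eta> \<le> m"
      using m(2) inverse_lp_value_in_ppv_values that by blast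
    then show ?thesis
      using pos m1 by (simp add: field_simps)
  qed
  have "(LEAST \<eta>. \<eta> \<in> lp_values W \<epsilon>) = 1 / m"
    by (rule Least_equality) (use min_in min_le in auto)
  moreover have "(GREATEST r. r \<in> ppv_values W \<epsilon>) = m"
    by (rule Greatest_equality) (use m in auto)
  \<comment> \<open>The minus sign in front of the logarithm undoes the reciprocal.\<close>
  ultimately have "C_NS_PPT (quantum_of W) \<epsilon> = R_PPV W \<epsilon>"
    using m1 by (simp add: C_NS_PPT_def R_PPV_def ns_ppt_values_eq_lp_values log_divide)
  moreover have "has_minimum (lp_values W \<epsilon>)"
    using min_in min_le by (auto simp: has_minimum_def)
  moreover have "has_maximum (ppv_values W \<epsilon>)"
    using m by (auto simp: has_maximum_def)
  ultimately show ?thesis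
    by (simp add: C_NS_def C_NS_PPT_def ns_values_eq_lp_values ns_ppt_values_eq_lp_values)
qed

end
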